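(* Let $n\ge2$. The moduli space $\mathcal{M}_{\mathcal{K}}$ for Kropina metrics of constant flag curvature $K=0$ on $\mathbb{E}^n$ consists of the single point $$(a_1,a_2,\dots,a_n)=(1,0,\dots,0)\in\mathbb{E}^n;$$ i.e. the unit length Killing vector fields of $(\mathbb{E}^n,h_0)$ form a single orbit under push-forward by isometries of $(\mathbb{E}^n,h_0)$, represented by the constant vector field with components $(1,0,\dots,0)$.
   Context: $h_0=(\delta_{ij})$ is the standard flat metric on $\mathbb{E}^n$, whose isometry group is the Euclidean group $E(n)$ (generated by rotations, reflections and translations). The Kropina metrics in question are the conic Finsler metrics $F(x,y)=\frac{h_0(y,y)}{2h_0(y,W)}$ on $\{h_0(y,W)>0\}$ determined by a Killing field $W$ of $(\mathbb{E}^n,h_0)$ with $h_0(W,W)=1$ everywhere. The moduli space $\mathcal{M}_{\mathcal{K}}$ is the set of orbits of such unit Killing fields under push-forward $W\mapsto\phi_*W$, $\phi\in E(n)$; each orbit corresponds to one conic isometry class of Kropina metrics, and an orbit is designated by the components $(a_1,\dots,a_n)$ of a constant representative. *)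

theory Defs
  imports "HOL-Analysis.Analysis"
begin

text \<open>
  The library has no \<open>C\<^sup>\<infinity>\<close> maps between Euclidean spaces. In finite dimension,
  \<open>C\<^sup>k\<^sup>+\<^sup>1\<close> means differentiable with every directional derivative of class \<open>C\<^sup>k\<close>.
\<close>

fun Ck_map :: "nat \<Rightarrow> ('a::euclidean_space \<Rightarrow> 'b::euclidean_space) \<Rightarrow> bool" where
  "Ck_map 0 f \<longleftrightarrow> continuous_on UNIV f"
| "Ck_map (Suc k) f \<longleftrightarrow> (\<forall>x. f differentiable at x) \<and>
     (\<forall>v. Ck_map k (\<lambda>x. frechet_derivative f (at x) v))"

definition smooth_map :: "('a::euclidean_space \<Rightarrow> 'b::euclidean_space) \<Rightarrow> bool" where
  "smooth_map f \<longleftrightarrow> (\<forall>k. Ck_map k f)"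

text \<open>
  A vector field on \<open>\<bbbE>\<^sup>n\<close> is a map \<open>W :: real ^ 'n \<Rightarrow> real ^ 'n\<close>, every tangent space being
  identified with \<open>real ^ 'n\<close>; the flat metric \<open>h\<^sub>0 = (\<delta>\<^sub>i\<^sub>j)\<close> is the inner product.
  As \<open>h\<^sub>0\<close> has constant components, \<open>(L\<^sub>W h\<^sub>0)(u, v) = h\<^sub>0(DW u, v) + h\<^sub>0(u, DW v)\<close>.
\<close>

definition lie_derivative_flat ::
    "(real ^ 'n \<Rightarrow> real ^ 'n) \<Rightarrow> real ^ 'n \<Rightarrow> real ^ 'n \<Rightarrow> real ^ 'n \<Rightarrow> real" where
  "lie_derivative_flat W x u v =
     frechet_derivative W (at x) u \<bullet> v + u \<bullet> frechet_derivative W (at x) v"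

definition killing_field :: "(real ^ 'n \<Rightarrow> real ^ 'n) \<Rightarrow> bool" where
  "killing_field W \<longleftrightarrow> smooth_map W \<and> (\<forall>x u v. lie_derivative_flat W x u v = 0)"

definition unit_killing_fields :: "(real ^ 'n \<Rightarrow> real ^ 'n) set" where
  "unit_killing_fields = {W. killing_field W \<and> (\<forall>x. W x \<bullet> W x = 1)}"

text \<open>Isometries in the Riemannian sense: diffeomorphisms \<open>\<phi>\<close> with \<open>\<phi>\<^sup>* h\<^sub>0 = h\<^sub>0\<close>.\<close>

definition flat_isometries :: "(real ^ 'n \<Rightarrow> real ^ 'n) set" where
  "flat_isometries = {\<phi>. bij \<phi> \<and> smooth_map \<phi> \<and> smooth_map (inv \<phi>) \<and>
     (\<forall>x u v. frechet_derivative \<phi> (at x) u \<bullet> frechet_derivative \<phi> (at x) v = u \<bullet> v)}"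

definition push_forward ::
    "(real ^ 'n \<Rightarrow> real ^ 'n) \<Rightarrow> (real ^ 'n \<Rightarrow> real ^ 'n) \<Rightarrow> real ^ 'n \<Rightarrow> real ^ 'n" where
  "push_forward \<phi> W p = frechet_derivative \<phi> (at (inv \<phi> p)) (W (inv \<phi> p))"

definition isometry_orbit :: "(real ^ 'n \<Rightarrow> real ^ 'n) \<Rightarrow> (real ^ 'n \<Rightarrow> real ^ 'n) set" where
  "isometry_orbit W = {push_forward \<phi> W | \<phi>. \<phi> \<in> flat_isometries}"

text \<open>
  The moduli space of the flat Kropina metrics \<open>F(x, y) = h\<^sub>0(y, y) / (2 h\<^sub>0(y, W))\<close>: such a
  metric is given by its unit Killing field \<open>W\<close>, and points are orbits of such fields.
\<close>

definition kropina_moduli_space :: "(real ^ 'n \<Rightarrow> real ^ 'n) set set" where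
  "kropina_moduli_space = isometry_orbit ` unit_killing_fields"

text \<open>The isometry group is the Euclidean group \<open>E(n)\<close>.\<close>

lemma Ck_map_const: "Ck_map k (\<lambda>x. c)"
  by (induction k arbitrary: c) simp_all

lemma smooth_map_affine:
  fixes A :: "'a::euclidean_space \<Rightarrow> 'b::euclidean_space"
  assumes "linear A"
  shows "smooth_map (\<lambda>x. A x + b)"
    and "frechet_derivative (\<lambda>x. A x + b) (at x) = A"
proof -
  have bl: "bounded_linear A"
    using assms by (simp add: linear_conv_bounded_linear)
  have der: "((\<lambda>x. A x + b) has_derivative A) (at x)" for x
    using has_derivative_add[OF bounded_linear_imp_has_derivative[OF bl] has_derivative_const] by simp
  show fd: "frechet_derivative (\<lambda>x. A x + b) (at x) = A" for x
    using frechet_derivative_at[OF der] by simp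
  have "Ck_map k (\<lambda>x. A x + b)" for k
  proof (cases k)
    case 0
    then show ?thesis
      using continuous_on_add[OF linear_continuous_on[OF bl] continuous_on_const] by simp
  next
    case (Suc m)
    then show ?thesis
      using der by (auto simp: fd Ck_map_const differentiable_def)
  qed
  then show "smooth_map (\<lambda>x. A x + b)"
    by (simp add: smooth_map_def)
qed

lemma smooth_map_differentiable: "smooth_map f \<Longrightarrow> f differentiable at x"
  unfolding smooth_map_def by (metis Ck_map.simps(2))

lemma flat_isometries_dist:
  fixes \<phi> :: "real ^ 'n \<Rightarrow> real ^ 'n"
  assumes "\<phi> \<in> flat_isometries"
  shows "dist (\<phi> x) (\<phi> y) = dist x y"
proof -
  let ?D = "\<lambda>x. frechet_derivative \<phi> (at x)"
  have bij: "bij \<phi>" and sm: "smooth_map \<phi>" "smooth_map (inv \<phi>)"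
    and pres: "\<And>x u v. ?D x u \<bullet> ?D x v = u \<bullet> v"
    using assms by (auto simp: flat_isometries_def)
  have nrm: "norm (?D x u) = norm u" for x u
    by (simp add: norm_eq_sqrt_inner pres)
  have lip: "norm (f x - f y) \<le> norm (x - y)"
    if f: "smooth_map f" and n: "\<And>x u. norm (frechet_derivative f (at x) u) = norm u"
    for f :: "real ^ 'n \<Rightarrow> real ^ 'n" and x y
  proof -
    have "norm (f x - f y) \<le> 1 * norm (x - y)"
    proof (rule differentiable_bound[of UNIV f "\<lambda>x. frechet_derivative f (at x)"])
      show "(f has_derivative frechet_derivative f (at x)) (at x within UNIV)" for x
        using smooth_map_differentiable[OF f] frechet_derivative_works by blast
      show "onorm (frechet_derivative f (at x)) \<le> 1" for x
        by (rule onorm_le) (simp add: n)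
    qed auto
    then show ?thesis by simp
  qed
  have inv_nrm: "norm (frechet_derivative (inv \<phi>) (at p) u) = norm u" for p u
  proof -
    have "frechet_derivative (\<phi> \<circ> inv \<phi>) (at p) =
        ?D (inv \<phi> p) \<circ> frechet_derivative (inv \<phi>) (at p)"
      by (rule frechet_derivative_compose) (auto intro: smooth_map_differentiable sm)
    moreover have "\<phi> \<circ> inv \<phi> = id"
      using bij_is_surj[OF bij] surj_iff by blast
    ultimately have "?D (inv \<phi> p) (frechet_derivative (inv \<phi>) (at p) u) = u"
      by (metis comp_apply frechet_derivative_id id_apply)
    then show ?thesis by (metis nrm)
  qed
  have "norm (inv \<phi> (\<phi> x) - inv \<phi> (\<phi> y)) \<le> norm (\<phi> x - \<phi> y)"
    by (rule lip[OF sm(2) inv_nrm])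
  then show ?thesis
    using lip[OF sm(1) nrm, of x y] bij by (simp add: dist_norm bij_is_inj)
qed

lemma flat_isometries_eq_euclidean_group:
  "(flat_isometries :: (real ^ 'n \<Rightarrow> real ^ 'n) set) =
     {\<phi>. \<exists>A b. orthogonal_transformation A \<and> \<phi> = (\<lambda>x. A x + b)}"
proof (intro equalityI subsetI)
  fix \<phi> :: "real ^ 'n \<Rightarrow> real ^ 'n"
  assume "\<phi> \<in> flat_isometries"
  then have "orthogonal_transformation (\<lambda>x. \<phi> x - \<phi> 0)"
    unfolding orthogonal_transformation_isometry
    by (simp add: dist_norm flat_isometries_dist[unfolded dist_norm])
  moreover have "\<phi> = (\<lambda>x. (\<phi> x - \<phi> 0) + \<phi> 0)" by simp
  ultimately show "\<phi> \<in> {\<phi>. \<exists>A b. orthogonal_transformation A \<and> \<phi> = (\<lambda>x. A x + b)}"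
    by blast
next
  fix \<phi> :: "real ^ 'n \<Rightarrow> real ^ 'n"
  assume "\<phi> \<in> {\<phi>. \<exists>A b. orthogonal_transformation A \<and> \<phi> = (\<lambda>x. A x + b)}"
  then obtain A b where A: "orthogonal_transformation A" and \<phi>: "\<phi> = (\<lambda>x. A x + b)"
    by blast
  have lin: "linear A" and bijA: "bij A"
    using A by (auto simp: orthogonal_transformation_linear orthogonal_transformation_bij)
  have A': "orthogonal_transformation (inv A)"
    using A by (rule orthogonal_transformation_inv)
  then have lin': "linear (inv A)"
    by (rule orthogonal_transformation_linear)
  have left: "inv A (\<phi> x - b) = x" for x
    using bijA by (simp add: \<phi> bij_is_inj)
  have right: "\<phi> (inv A (y - b)) = y" for y
    using bijA by (simp add: \<phi> bij_is_surj surj_f_inv_f)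
  have bij: "bij \<phi>"
    by (rule o_bij[of "\<lambda>y. inv A (y - b)"]) (auto simp: left right)
  have "inv \<phi> = (\<lambda>y. inv A (y - b))"
    by (rule inv_equality) (auto simp: left right)
  also have "\<dots> = (\<lambda>y. inv A y + - inv A b)"
    using lin' by (simp add: linear_diff)
  finally have inv: "inv \<phi> = (\<lambda>y. inv A y + - inv A b)" .
  show "\<phi> \<in> flat_isometries"
    unfolding flat_isometries_def mem_Collect_eq inv
    using bij smooth_map_affine[OF lin, of b] smooth_map_affine(1)[OF lin', of "- inv A b"] A
    by (auto simp: \<phi> orthogonal_transformation_def)
qed

end

theory Submission
  imports Defs
begin

text \<open>
  The Killing equation makes \<open>W x \<bullet> (x - y) = W y \<bullet> (x - y)\<close> for all \<open>x\<close>, \<open>y\<close>. Hence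
  \<open>V = W - W 0\<close> satisfies \<open>V x \<bullet> y = - V y \<bullet> x\<close>. If \<open>W\<close> is bounded, the right-hand side is
  a linear functional of \<open>x\<close> that is bounded on the whole space, so \<open>V y = 0\<close>. Unit Killing
  fields are thus constant, and orthogonal maps act transitively on unit vectors.
\<close>

text \<open>A Killing field has constant inner product with the velocity of a geodesic. Here the
  geodesic is the straight line through \<open>y\<close> and \<open>x\<close>, with velocity
  \<open>v = x - y\<close>.\<close>

lemma killing_field_inner_diff:
  assumes "killing_field W"
  shows "W x \<bullet> (x - y) = W y \<bullet> (x - y)"
proof -
  define v where "v = x - y"
  let ?D = "\<lambda>p. frechet_derivative W (at p)"
  have smooth: "smooth_map W" and "lie_derivative_flat W p v v = 0" for p
    using assms by (auto simp: killing_field_def)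
  then have skew: "?D p v \<bullet> v = 0" for p
    by (simp add: lie_derivative_flat_def inner_commute[of v])
  have der: "(W has_derivative ?D p) (at p)" for p
    using smooth_map_differentiable[OF smooth] frechet_derivative_works by blast
  have "((\<lambda>t. W (y + t *\<^sub>R v) \<bullet> v) has_derivative (\<lambda>s. 0)) (at t within UNIV)" for t
  proof -
    have "((\<lambda>t. W (y + t *\<^sub>R v)) has_derivative (\<lambda>s. ?D (y + t *\<^sub>R v) (s *\<^sub>R v))) (at t)"
      by (rule has_derivative_compose[OF _ der]) (auto intro!: derivative_eq_intros)
    moreover have "?D (y + t *\<^sub>R v) (s *\<^sub>R v) = s *\<^sub>R ?D (y + t *\<^sub>R v) v" for s
      using has_derivative_linear[OF der] by (rule linear_scale)
    ultimately show ?thesis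
      using has_derivative_inner_left[of "\<lambda>t. W (y + t *\<^sub>R v)" "\<lambda>s. s *\<^sub>R ?D (y + t *\<^sub>R v) v" "at t" v]
      by (simp add: skew)
  qed
  \<comment> \<open>The parameters 1 and 0 give the points \<open>x\<close> and
    \<open>y\<close>.\<close>
  then have "W (y + 1 *\<^sub>R v) \<bullet> v = W (y + 0 *\<^sub>R v) \<bullet> v"
    by (intro has_derivative_zero_unique[of UNIV "\<lambda>t. W (y + t *\<^sub>R v) \<bullet> v"]) auto
  then show ?thesis
    by (simp add: v_def)
qed

lemma bounded_killing_field_constant:
  assumes kill: "killing_field W" and bound: "\<And>x. norm (W x) \<le> B"
  shows "W x = W 0"
proof -
  define V where "V = (\<lambda>p. W p - W 0)"
  \<comment> \<open>Polarisation: the pairs with 0 give \<open>V p \<bullet> p = 0\<close> and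
    \<open>V q \<bullet> q = 0\<close>, so expanding
    \<open>(V p - V q) \<bullet> (p - q) = 0\<close> leaves only the mixed terms.\<close>
  have skew: "V p \<bullet> q = - (V q \<bullet> p)" for p q
    using killing_field_inner_diff[OF kill, of p q] killing_field_inner_diff[OF kill, of p 0]
      killing_field_inner_diff[OF kill, of q 0]
    by (simp add: V_def inner_diff_left inner_diff_right)
  have V_bound: "norm (V p) \<le> 2 * B" for p
    using norm_triangle_ineq4[of "W p" "W 0"] bound[of p] bound[of 0] by (simp add: V_def)
  have functional_bound: "\<bar>V x \<bullet> p\<bar> \<le> 2 * B * norm x" for p
  proof -
    have "\<bar>V x \<bullet> p\<bar> = \<bar>V p \<bullet> x\<bar>"
      using skew[of x p] by simp
    also have "\<dots> \<le> norm (V p) * norm x"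
      by (rule Cauchy_Schwarz_ineq2)
    also have "\<dots> \<le> 2 * B * norm x"
      by (intro mult_right_mono V_bound norm_ge_zero)
    finally show ?thesis .
  qed
  have "V x = 0"
  proof (rule ccontr)
    assume "V x \<noteq> 0"
    then have pos: "V x \<bullet> V x > 0"
      by simp
    \<comment> \<open>The multiple of \<open>V x\<close> is scaled so that its inner product with
      \<open>V x\<close> is \<open>2 * B * norm x + 1\<close>, just above the bound.\<close>
    show False
      using functional_bound[of "((2 * B * norm x + 1) / (V x \<bullet> V x)) *\<^sub>R V x"] pos by simp
  qed
  then show ?thesis
    by (simp add: V_def)
qed

lemma killing_field_constant_field: "killing_field (\<lambda>x. a)"
  by (simp add: killing_field_def smooth_map_def Ck_map_const lie_derivative_flat_def
      frechet_derivative_const)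

lemma unit_killing_fields_eq_constant:
  "unit_killing_fields = {(\<lambda>x. a) | a. norm a = 1}"
proof (intro equalityI subsetI)
  fix W :: "real ^ 'n \<Rightarrow> real ^ 'n"
  assume "W \<in> unit_killing_fields"
  then have kill: "killing_field W" and unit: "norm (W x) = 1" for x
    by (auto simp: unit_killing_fields_def norm_eq_1)
  have "W x = W 0" for x
    using bounded_killing_field_constant[OF kill] unit by (metis order_refl)
  then have "W = (\<lambda>x. W 0)"
    by blast
  then show "W \<in> {(\<lambda>x. a) | a. norm a = 1}"
    using unit by blast
qed (auto simp: unit_killing_fields_def killing_field_constant_field norm_eq_1)

text \<open>An isometry acts on a constant field through its linear part alone, and the orthogonal
  group is transitive on each sphere about 0.\<close>

lemma isometry_orbit_constant_field:
  "isometry_orbit (\<lambda>x. a) = {(\<lambda>x. b) | b. norm b = norm a}"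
proof -
  have push: "push_forward (\<lambda>x. A x + c) (\<lambda>x. a) = (\<lambda>x. A a)"
    if "orthogonal_transformation A" for A c
    using smooth_map_affine(2)[OF orthogonal_transformation_linear[OF that]]
    by (simp add: push_forward_def fun_eq_iff)
  show ?thesis
  proof (intro equalityI subsetI)
    fix U assume "U \<in> isometry_orbit (\<lambda>x. a)"
    then obtain A where "orthogonal_transformation A" "U = (\<lambda>x. A a)"
      unfolding isometry_orbit_def flat_isometries_eq_euclidean_group using push by blast
    then show "U \<in> {(\<lambda>x. b) | b. norm b = norm a}"
      using orthogonal_transformation_norm by blast
  next
    fix U :: "real ^ 'a \<Rightarrow> real ^ 'a"
    assume "U \<in> {(\<lambda>x. b) | b. norm b = norm a}"
    then obtain b where U: "U = (\<lambda>x. b)" and "norm a = norm b"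
      by auto
    then obtain A where A: "orthogonal_transformation A" "A a = b"
      by (metis orthogonal_transformation_exists)
    \<comment> \<open>Any translation part would do; 0 is the simplest choice.\<close>
    then have "push_forward (\<lambda>x. A x + 0) (\<lambda>x. a) = U"
      by (simp only: push U)
    then show "U \<in> isometry_orbit (\<lambda>x. a)"
      unfolding isometry_orbit_def flat_isometries_eq_euclidean_group using A(1) by blast
  qed
qed

theorem theorem7p7:
  fixes one :: "'n::finite"  (* the index playing the role of the first coordinate *)
  assumes "CARD('n) \<ge> 2"
  shows "(kropina_moduli_space :: (real ^ 'n \<Rightarrow> real ^ 'n) set set) =
           {isometry_orbit (\<lambda>x. axis one 1)}
       \<and> (unit_killing_fields :: (real ^ 'n \<Rightarrow> real ^ 'n) set) =
           isometry_orbit (\<lambda>x. axis one 1)"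
proof
  show single: "(unit_killing_fields :: (real ^ 'n \<Rightarrow> real ^ 'n) set) =
      isometry_orbit (\<lambda>x. axis one 1)"
    by (simp add: unit_killing_fields_eq_constant isometry_orbit_constant_field)
  have "isometry_orbit W = isometry_orbit (\<lambda>x. axis one 1)"
    if "W \<in> unit_killing_fields" for W :: "real ^ 'n \<Rightarrow> real ^ 'n"
    using that by (auto simp: unit_killing_fields_eq_constant isometry_orbit_constant_field)
  \<comment> \<open>This field shows that the moduli space is nonempty, so it is the whole
    singleton.\<close>
  moreover have "(\<lambda>x. axis one 1) \<in> (unit_killing_fields :: (real ^ 'n \<Rightarrow> real ^ 'n) set)"
    by (auto simp: unit_killing_fields_eq_constant)
  ultimately show "(kropina_moduli_space :: (real ^ 'n \<Rightarrow> real ^ 'n) set set) =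
      {isometry_orbit (\<lambda>x. axis one 1)}"
    unfolding kropina_moduli_space_def by blast
qed

end
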